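(* Let $\mathcal{B}(z)=\sum_{n\ge 0} |\mathcal{S}_n\cap Av(\mathbf{4123},\mathbf{1324},\mathbf{3124})|\, z^n$ be the generating function for $Av(\mathbf{4123},\mathbf{1324},\mathbf{3124})$. Then $$\mathcal{B}(z) = \frac{(1-3z)(1+\sqrt{1-4z})}{2\sqrt{1-4z}\,(1-3z+z^2)}.$$
   Context: A permutation $\sigma$ contains a pattern $\pi$ if some subsequence of $\sigma$ is order-isomorphic to $\pi$; otherwise $\sigma$ avoids $\pi$. For a set $B$ of patterns, $Av(B)$ is the set of permutations avoiding every element of $B$, and $\mathcal{S}_n$ is the set of permutations of length $n$ (the empty permutation is counted for $n=0$). *)

theory Defs
  imports
    Complex_Main
    "HOL-Library.Sublist"
    "HOL-Combinatorics.Multiset_Permutations"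
    "HOL-Computational_Algebra.Formal_Power_Series"
begin

(* Permutations and patterns are written in one-line notation, as lists over nat;
   the empty list is the unique permutation of length 0. *)

definition perms :: "nat \<Rightarrow> nat list set" where
  "perms n = permutations_of_set {1..n}"

definition order_isomorphic :: "nat list \<Rightarrow> nat list \<Rightarrow> bool" where
  "order_isomorphic xs ys \<longleftrightarrow>
     length xs = length ys \<and>
     (\<forall>i<length xs. \<forall>j<length xs. xs ! i < xs ! j \<longleftrightarrow> ys ! i < ys ! j)"

(* subseq is the library's subsequence relation: entries need not be adjacent. *)
definition contains_pattern :: "nat list \<Rightarrow> nat list \<Rightarrow> bool" where
  "contains_pattern \<sigma> \<pi> \<longleftrightarrow> (\<exists>xs. subseq xs \<sigma> \<and> order_isomorphic xs \<pi>)"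

definition Av :: "nat list set \<Rightarrow> nat list set" where
  "Av B = {\<sigma> \<in> (\<Union>n. perms n). \<forall>\<pi>\<in>B. \<not> contains_pattern \<sigma> \<pi>}"

definition perm_class_gf :: "nat list set \<Rightarrow> real fps" where
  "perm_class_gf C = Abs_fps (\<lambda>n. real (card (perms n \<inter> C)))"

(* For a series with positive constant term, this is the square root whose constant
   term is positive. *)
definition fps_sqrt :: "real fps \<Rightarrow> real fps" where
  "fps_sqrt F = fps_radical root 2 F"

lemma fps_sqrt_nth_0: "fps_nth (fps_sqrt F) 0 = sqrt (fps_nth F 0)"
  by (simp add: fps_sqrt_def sqrt_def)

lemma fps_sqrt_power2:
  assumes "fps_nth F 0 > 0"
  shows "fps_sqrt F ^ 2 = F"
  using power_radical[of F root 1] assms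
  by (simp add: fps_sqrt_def numeral_2_eq_2 del: power_Suc)

end

theory Submission
  imports Defs
begin

text \<open>
  Inserting a new maximum into an avoider at some site gives an avoider if and only if the prefix
  before the site avoids 132 and 312, i.e. all its entries are left-to-right minima or maxima, and
  the suffix after it avoids 123. The active sites thus form an interval, and the pattern of minima
  and maxima inside this interval determines the number of descendants of each length. There are
  only four kinds of patterns, which yields a generating tree with labels carrying at most two
  numbers.

  Write $d_r$ for the generating function of the tree rooted at label \<open>D r\<close>. These satisfy
  $d_{r+1} - d_r = z d_{r+2} + z^2 S_r$ and $d_0 = 1 + z d_1$ with explicit $S_r$, and such a
  system has at most one solution in power series, since the coefficients of $z^n$ are determined
  by those of lower order. With $c = 2/(1+\sqrt{1-4z})$, the root of $z x^2 - x + 1$, and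
  $q = 1/(1-2z)$, one finds a solution of the form $\lambda c^r + \mu + \nu q^r$, and
  $d_0 = \lambda + \mu + \nu$.
\<close>

section \<open>The generating tree\<close>

datatype label = D nat | A nat nat | B nat nat | C

text \<open>Children are listed from the leftmost active site to the rightmost: entry
  \<open>t\<close> belongs to site \<open>lo + t\<close> in \<open>state_children\<close>.\<close>

fun children :: "label \<Rightarrow> label list" where
  "children (D r) = D (Suc r) # map (\<lambda>i. A i (r - i)) [1..<Suc r]"
| "children (A p k) = D (Suc p) # map (\<lambda>i. A i (p - i)) [1..<Suc p] @ map (\<lambda>i. B i (k - i)) [0..<Suc k]"
| "children (B j k) = C # map (\<lambda>i. B i (j - i)) [0..<Suc j] @ map (\<lambda>i. B i (k - i)) [0..<Suc k]"
| "children C = [C, B 0 0]"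

primrec tree_count :: "nat \<Rightarrow> label \<Rightarrow> nat" where
  "tree_count 0 l = 1"
| "tree_count (Suc m) l = (\<Sum>l'\<leftarrow>children l. tree_count m l')"

definition tree_gf :: "label \<Rightarrow> real fps" where
  "tree_gf l = Abs_fps (\<lambda>m. real (tree_count m l))"

section \<open>Solving the generating tree\<close>

lemma tree_gf_rec: "tree_gf l = 1 + fps_X * (\<Sum>l'\<leftarrow>children l. tree_gf l')"
proof (rule fps_ext)
  fix n
  have *: "fps_nth (\<Sum>l'\<leftarrow>ls. tree_gf l') m = real (\<Sum>l'\<leftarrow>ls. tree_count m l')" for ls m
    by (induction ls) (auto simp: tree_gf_def)
  show "fps_nth (tree_gf l) n = fps_nth (1 + fps_X * (\<Sum>l'\<leftarrow>children l. tree_gf l')) n"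
  proof (cases n)
    case (Suc m)
    thus ?thesis by (simp add: *) (simp add: tree_gf_def)
  qed (simp add: tree_gf_def)
qed

text \<open>Labels \<open>B\<close> enter the lists of children only in whole blocks of this form,
  so the equations close over block sums; likewise for \<open>A\<close> and
  \<open>sum_A\<close>.\<close>

definition sum_B :: "nat \<Rightarrow> real fps" where
  "sum_B k = (\<Sum>i\<le>k. tree_gf (B i (k - i)))"

definition sum_A :: "nat \<Rightarrow> real fps" where
  "sum_A r = (\<Sum>i=1..r. tree_gf (A i (r - i)))"

lemma sum_B_list: "(\<Sum>i\<leftarrow>[0..<Suc k]. tree_gf (B i (k - i))) = sum_B k"
  unfolding sum_B_def by (metis atLeast0LessThan lessThan_Suc_atMost sum_set_upt_conv_sum_list_nat set_upt)

lemma sum_A_list: "(\<Sum>i\<leftarrow>[1..<Suc r]. tree_gf (A i (r - i))) = sum_A r"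
  unfolding sum_A_def by (metis atLeastLessThanSuc_atLeastAtMost sum_set_upt_conv_sum_list_nat set_upt)

lemma gf_C: "tree_gf C = 1 + fps_X * (tree_gf C + sum_B 0)"
  by (subst tree_gf_rec) (simp add: sum_B_def)

lemma gf_B: "tree_gf (B j k) = 1 + fps_X * (tree_gf C + sum_B j + sum_B k)"
  by (subst tree_gf_rec) (simp del: upt_Suc add: o_def sum_B_list add.assoc)

lemma gf_D: "tree_gf (D r) = 1 + fps_X * (tree_gf (D (Suc r)) + sum_A r)"
  by (subst tree_gf_rec) (simp del: upt_Suc add: o_def sum_A_list[simplified])

text \<open>The children of \<open>A p k\<close> are those of \<open>D p\<close> followed by one
  block of \<open>B\<close> labels.\<close>

lemma gf_A: "tree_gf (A p k) = tree_gf (D p) + fps_X * sum_B k"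
  by (subst tree_gf_rec)
     (simp del: upt_Suc add: o_def sum_A_list[simplified] sum_B_list gf_D[of p] algebra_simps)

text \<open>This sums \<open>gf_B\<close> over a block: both arguments run through
  \<open>0..k\<close>, one of them backwards, so the two resulting sums agree.\<close>

lemma sum_B_eq:
  "sum_B k = of_nat (Suc k) * (1 + fps_X * tree_gf C) + 2 * fps_X * (\<Sum>i\<le>k. sum_B i)"
proof -
  have flip: "(\<Sum>i\<le>k. sum_B (k - i)) = (\<Sum>i\<le>k. sum_B i)"
    by (rule sum.reindex_bij_witness[of _ "\<lambda>i. k - i" "\<lambda>i. k - i"]) auto
  have "sum_B k = (\<Sum>i\<le>k. (1 + fps_X * tree_gf C) + fps_X * sum_B i + fps_X * sum_B (k - i))"
    unfolding sum_B_def[of k] by (rule sum.cong) (simp_all add: gf_B algebra_simps)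
  also have "\<dots> = of_nat (Suc k) * (1 + fps_X * tree_gf C)
      + fps_X * (\<Sum>i\<le>k. sum_B i) + fps_X * (\<Sum>i\<le>k. sum_B (k - i))"
    by (simp only: sum.distrib sum_distrib_left sum_constant card_atMost distrib_left)
  finally show ?thesis unfolding flip by (simp add: algebra_simps)
qed

lemma sum_B_0: "(1 - 2 * fps_X) * sum_B 0 = 1 + fps_X * tree_gf C"
  using sum_B_eq[of 0] by (simp add: algebra_simps)

text \<open>Subtracting consecutive instances of \<open>sum_B_eq\<close> removes the partial sums
  and leaves a first-order recurrence.\<close>

lemma sum_B_Suc: "(1 - 2 * fps_X) * sum_B (Suc k) = sum_B k + (1 + fps_X * tree_gf C)"
  using sum_B_eq[of k] sum_B_eq[of "Suc k"] by (simp add: algebra_simps)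

lemma gf_C_closed: "(1 - 3 * fps_X + fps_X ^ 2) * tree_gf C = 1 - fps_X"
  using gf_C sum_B_0 by algebra

text \<open>The recurrence \<open>sum_B_Suc\<close> has ratio \<open>q\<close>, and after scaling by
  \<open>?P\<close> its fixed point is \<open>- ?T\<close>. The scaling avoids a division by
  \<open>fps_X\<close>, which is not a unit.\<close>

lemma sum_B_closed:
  assumes q: "(1 - 2 * fps_X) * q = 1"
  shows "2 * fps_X * (1 - 3 * fps_X + fps_X ^ 2) * sum_B k = (1 - 2 * fps_X) * (q ^ Suc k - 1)"
    (is "?P * _ = ?T * _")
proof -
  have K: "?P * (1 + fps_X * tree_gf C) = 2 * fps_X * ?T"
    using gf_C_closed by algebra
  have "?T \<noteq> 0" using q by auto
  show ?thesis
  proof (induction k)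
    case 0
    have "?T * (?P * sum_B 0) = ?P * (?T * sum_B 0)" by (rule mult.left_commute)
    also have "\<dots> = ?T * (?T * q - ?T)" unfolding sum_B_0 K q by simp
    also have "?T * q - ?T = ?T * (q ^ Suc 0 - 1)"
      by (simp only: right_diff_distrib power_Suc power_0 mult_1_right)
    finally show ?case using \<open>?T \<noteq> 0\<close> by (metis mult_cancel_left)
  next
    case (Suc k)
    have "?T * (?P * sum_B (Suc k)) = ?P * (?T * sum_B (Suc k))" by (rule mult.left_commute)
    also have "\<dots> = ?P * sum_B k + ?P * (1 + fps_X * tree_gf C)"
      unfolding sum_B_Suc by (rule distrib_left)
    also have "\<dots> = ?T * (q ^ Suc k - ?T)"
      unfolding Suc.IH K by (simp del: power_Suc add: algebra_simps)
    also have "q ^ Suc k - ?T = ?T * (q ^ Suc (Suc k) - 1)"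
      unfolding right_diff_distrib power_Suc[of q "Suc k"] mult.assoc[symmetric] q by simp
    finally show ?case using \<open>?T \<noteq> 0\<close> by (metis mult_cancel_left)
  qed
qed

text \<open>By \<open>gf_A\<close>, each summand splits into a term in \<open>i\<close> and a term
  in \<open>r - i\<close>, so a step in \<open>r\<close> adds one term of each kind.\<close>

lemma sum_A_Suc: "sum_A (Suc r) = sum_A r + tree_gf (D (Suc r)) + fps_X * sum_B r"
proof -
  have *: "sum_A r = (\<Sum>i=1..r. tree_gf (D i)) + fps_X * (\<Sum>k<r. sum_B k)" for r
  proof -
    have "sum_A r = (\<Sum>i=1..r. tree_gf (D i)) + fps_X * (\<Sum>i=1..r. sum_B (r - i))"
      unfolding sum_A_def by (simp add: gf_A sum.distrib sum_distrib_left)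
    also have "(\<Sum>i=1..r. sum_B (r - i)) = (\<Sum>k<r. sum_B k)"
      by (rule sum.reindex_bij_witness[of _ "\<lambda>i. r - i" "\<lambda>i. r - i"]) auto
    finally show ?thesis .
  qed
  show ?thesis unfolding *[of "Suc r"] *[of r] by (simp add: algebra_simps)
qed

lemma gf_D_0: "tree_gf (D 0) = 1 + fps_X * tree_gf (D 1)"
  using gf_D[of 0] by (simp add: sum_A_def)

lemma gf_D_Suc:
  "tree_gf (D (Suc r)) = tree_gf (D r) + fps_X * tree_gf (D (Suc (Suc r))) + fps_X ^ 2 * sum_B r"
proof -
  have "tree_gf (D (Suc r)) - tree_gf (D r)
      = (1 + fps_X * (tree_gf (D (Suc (Suc r))) + sum_A (Suc r)))
        - (1 + fps_X * (tree_gf (D (Suc r)) + sum_A r))"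
    by (simp only: gf_D[symmetric])
  also have "\<dots> = fps_X * tree_gf (D (Suc (Suc r))) + fps_X ^ 2 * sum_B r"
    unfolding sum_A_Suc by (simp add: algebra_simps power2_eq_square)
  finally show ?thesis by (simp add: algebra_simps)
qed

text \<open>One boundary relation suffices for this second-order recurrence because its highest term
  carries a factor \<open>fps_X\<close>. The outer induction is on the degree, the inner one climbs
  in \<open>r\<close> from the boundary.\<close>

lemma linear_recurrence_unique:
  fixes u v f :: "nat \<Rightarrow> real fps"
  assumes "u 0 = a + fps_X * u 1" "v 0 = a + fps_X * v 1"
    and u: "\<And>r. u (Suc r) = u r + fps_X * u (Suc (Suc r)) + f r"
    and v: "\<And>r. v (Suc r) = v r + fps_X * v (Suc (Suc r)) + f r"
  shows "u r = v r"
proof -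
  define e where "e r = u r - v r" for r
  have e0: "e 0 = fps_X * e 1" using assms(1,2) by (simp add: e_def algebra_simps)
  have eS: "e (Suc r) = e r + fps_X * e (Suc (Suc r))" for r
    unfolding e_def u[of r] v[of r] by (simp add: algebra_simps)
  have "fps_nth (e r) n = 0" for n r
  proof (induction n arbitrary: r)
    case 0
    show ?case
    proof (induction r)
      case 0
      show ?case by (subst e0) simp
    next
      case (Suc r)
      thus ?case by (subst eS) simp
    qed
  next
    case (Suc n)
    show ?case
    proof (induction r)
      case 0
      show ?case by (subst e0) (simp add: Suc)
    next
      case (Suc r)
      thus ?case by (subst eS) (simp add: \<open>\<And>r. fps_nth (e r) n = 0\<close>)
    qed
  qed
  hence "e r = 0" by (simp add: fps_eq_iff)
  thus ?thesis by (simp add: e_def)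
qed

lemma gf_root:
  "tree_gf (D 0) = ((1 - 3 * fps_X) * (1 + fps_sqrt (1 - 4 * fps_X))) /
     (2 * fps_sqrt (1 - 4 * fps_X) * (1 - 3 * fps_X + fps_X ^ 2))"
proof -
  define s where "s = fps_sqrt (1 - 4 * fps_X)"
  define P :: "real fps" where "P = 1 - 3 * fps_X + fps_X ^ 2"
  define q :: "real fps" where "q = inverse (1 - 2 * fps_X)"
  \<comment> \<open>\<open>h\<close> is the reciprocal of the root \<open>c\<close>; it gives the
    polynomial relations \<open>h * c = 1\<close> and \<open>fps_X = h * (1 - h)\<close>.\<close>
  define h where "h = fps_const (1/2) * (1 + s)"
  define c where "c = inverse h"
  have s2: "s ^ 2 = 1 - 4 * fps_X"
    unfolding s_def by (rule fps_sqrt_power2) simp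
  have s0: "fps_nth s 0 = 1"
    by (simp add: s_def fps_sqrt_nth_0)
  have h2: "2 * h = 1 + s"
    unfolding h_def numeral_fps_const by (simp only: mult.assoc[symmetric] fps_const_mult) simp
  have q: "(1 - 2 * fps_X) * q = 1"
    unfolding q_def by (rule inverse_mult_eq_1') simp
  have c: "h * c = 1"
    unfolding c_def by (rule inverse_mult_eq_1') (simp add: h_def s0)
  have hX: "fps_X = h * (1 - h)"
  proof -
    have "4 * fps_X = 4 * (h * (1 - h))" using h2 s2 by algebra
    thus ?thesis by simp
  qed
  have Xc: "fps_X * c = 1 - h" using c hX by algebra
  hence Xc2: "2 * (fps_X * c) = 1 - s" using h2 by algebra
  \<comment> \<open>The factor \<open>2 * P * s ^ 2\<close> clears the denominators of the three
    coefficients.\<close>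
  define u where "u r = 2 * P * s ^ 2 * tree_gf (D r)" for r
  \<comment> \<open>The constant and the \<open>q ^ r\<close> term are particular solutions for the
    two parts of \<open>f\<close>; the \<open>c ^ r\<close> term solves the homogeneous recurrence,
    with its coefficient fixed by the boundary relation.\<close>
  define v where "v r = - 2 * fps_X * c * (1 - 3 * fps_X) * c ^ r + (1 - 2 * fps_X) * s ^ 2
      + (1 - 2 * fps_X) ^ 2 * q ^ r" for r
  define f where "f r = fps_X * s ^ 2 * (1 - 2 * fps_X) * (q ^ Suc r - 1)" for r
  have "u 0 = v 0"
  proof (rule linear_recurrence_unique)
    show "u 0 = 2 * P * s ^ 2 + fps_X * u 1"
      unfolding u_def using gf_D_0 by algebra
    show "v 0 = 2 * P * s ^ 2 + fps_X * v 1"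
    proof -
      \<comment> \<open>Doubling lets \<open>2 * (fps_X * c)\<close> be replaced by
        \<open>1 - s\<close>.\<close>
      have "2 * v 0 = - 2 * (2 * (fps_X * c)) * (1 - 3 * fps_X) + 2 * (1 - 2 * fps_X) * s ^ 2
          + 2 * (1 - 2 * fps_X) ^ 2"
        unfolding v_def power_0 by algebra
      also have "\<dots> = 4 * P * s ^ 2 - (2 * (fps_X * c)) ^ 2 * (1 - 3 * fps_X)
          + 2 * fps_X * (1 - 2 * fps_X) * s ^ 2 + 2 * fps_X * (1 - 2 * fps_X)"
        unfolding Xc2 P_def using s2 by algebra
      also have "\<dots> = 4 * P * s ^ 2 - (2 * (fps_X * c)) ^ 2 * (1 - 3 * fps_X)
          + 2 * fps_X * (1 - 2 * fps_X) * s ^ 2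
          + 2 * fps_X * (1 - 2 * fps_X) * ((1 - 2 * fps_X) * q)"
        unfolding q by simp
      also have "\<dots> = 2 * (2 * P * s ^ 2 + fps_X * v 1)"
        unfolding v_def power_one_right by algebra
      finally show ?thesis by (simp only: mult_cancel_left) simp
    qed
    show "u (Suc r) = u r + fps_X * u (Suc (Suc r)) + f r" for r
    proof -
      have "2 * P * s ^ 2 * (fps_X ^ 2 * sum_B r)
          = fps_X * s ^ 2 * (2 * fps_X * P * sum_B r)"
        by (simp add: power2_eq_square algebra_simps)
      also have "\<dots> = f r"
        unfolding P_def sum_B_closed[OF q] f_def by (simp only: mult.assoc)
      finally show ?thesis
        unfolding u_def gf_D_Suc[of r] by (simp add: algebra_simps)
    qed
    show "v (Suc r) = v r + fps_X * v (Suc (Suc r)) + f r" for r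
    proof -
      \<comment> \<open>Naming the powers turns the claim into polynomial identities within reach of
        \<open>algebra\<close>.\<close>
      obtain Q K where Q: "Q = q ^ r" and K: "K = c ^ r" by blast
      have "fps_X * c * c = c - 1" using c Xc by algebra
      hence "c * K = K + fps_X * (c * (c * K))" by algebra
      hence 1: "t * (c * K) = t * K + fps_X * (t * (c * (c * K)))" for t
        by (metis (no_types) distrib_left mult.left_commute)
      have 2: "(1 - 2 * fps_X) ^ 2 * (q * Q) = (1 - 2 * fps_X) ^ 2 * Q
          + fps_X * ((1 - 2 * fps_X) ^ 2 * (q * (q * Q)))
          + fps_X * (1 - 4 * fps_X) * (1 - 2 * fps_X) * (q * Q)"
        using q by algebra
      show ?thesis
        unfolding v_def f_def power_Suc s2 Q[symmetric] K[symmetric] 1[of "- 2 * fps_X * c * (1 - 3 * fps_X)"] 2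
        by algebra
    qed
  qed
  hence "s * (tree_gf (D 0) * (2 * s * P))
      = - (2 * (fps_X * c)) * (1 - 3 * fps_X) + (1 - 2 * fps_X) * s ^ 2 + (1 - 2 * fps_X) ^ 2"
    unfolding u_def v_def power_0 by algebra
  \<comment> \<open>The last two terms add up to
    \<open>2 * (1 - 2 * fps_X) * (1 - 3 * fps_X)\<close>, so \<open>1 - 3 * fps_X\<close> splits
    off; the cofactor is \<open>s + (1 - 4 * fps_X) = s + s ^ 2\<close>.\<close>
  also have "\<dots> = s * ((1 - 3 * fps_X) * (1 + s))"
    unfolding Xc2 using s2 by algebra
  finally have "s * (tree_gf (D 0) * (2 * s * P)) = s * ((1 - 3 * fps_X) * (1 + s))" .
  moreover have "s \<noteq> 0" using s0 by auto
  ultimately have "tree_gf (D 0) * (2 * s * P) = (1 - 3 * fps_X) * (1 + s)"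
    by (metis mult_cancel_left)
  moreover have "2 * s * P \<noteq> 0"
  proof -
    have "fps_nth (2 * s * P) 0 \<noteq> 0" by (simp add: P_def s0)
    thus ?thesis by auto
  qed
  ultimately show ?thesis
    unfolding s_def P_def by (metis nonzero_mult_div_cancel_right)
qed

section \<open>Inserting a new maximum\<close>

definition good :: "nat list \<Rightarrow> bool" where
  "good \<sigma> \<longleftrightarrow> \<not> (\<exists>a b c d. subseq [a, b, c, d] \<sigma> \<and>
     (b < c \<and> c < d \<and> d < a \<or> a < c \<and> c < b \<and> b < d \<or> b < c \<and> c < a \<and> a < d))"

definition no_132_312 :: "nat list \<Rightarrow> bool" where
  "no_132_312 xs \<longleftrightarrow> \<not> (\<exists>a b c. subseq [a, b, c] xs \<and> (a < c \<and> c < b \<or> b < c \<and> c < a))"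

definition no_123 :: "nat list \<Rightarrow> bool" where
  "no_123 xs \<longleftrightarrow> \<not> (\<exists>a b c. subseq [a, b, c] xs \<and> a < b \<and> b < c)"

definition no_12 :: "nat list \<Rightarrow> bool" where
  "no_12 xs \<longleftrightarrow> \<not> (\<exists>a b. subseq [a, b] xs \<and> a < b)"

lemma contains_pattern_4:
  "contains_pattern \<sigma> [p, q, r, s] \<longleftrightarrow>
     (\<exists>a b c d. subseq [a, b, c, d] \<sigma> \<and> order_isomorphic [a, b, c, d] [p, q, r, s])"
proof -
  have "length xs = 4 \<longleftrightarrow> (\<exists>a b c d. xs = [a, b, c, d])" for xs :: "nat list"
    by (auto simp: numeral_eq_Suc length_Suc_conv)
  moreover have "order_isomorphic xs [p, q, r, s] \<Longrightarrow> length xs = 4" for xs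
    by (simp add: order_isomorphic_def)
  ultimately show ?thesis unfolding contains_pattern_def by metis
qed

lemma good_iff:
  "good \<sigma> \<longleftrightarrow> (\<forall>\<pi>\<in>{[4, 1, 2, 3], [1, 3, 2, 4], [3, 1, 2, 4]}. \<not> contains_pattern \<sigma> \<pi>)"
proof -
  have iso: "order_isomorphic [a, b, c, d] [p, q, r, s] \<longleftrightarrow>
      (a < b \<longleftrightarrow> p < q) \<and> (a < c \<longleftrightarrow> p < r) \<and> (a < d \<longleftrightarrow> p < s) \<and>
      (b < a \<longleftrightarrow> q < p) \<and> (b < c \<longleftrightarrow> q < r) \<and> (b < d \<longleftrightarrow> q < s) \<and>
      (c < a \<longleftrightarrow> r < p) \<and> (c < b \<longleftrightarrow> r < q) \<and> (c < d \<longleftrightarrow> r < s) \<and>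
      (d < a \<longleftrightarrow> s < p) \<and> (d < b \<longleftrightarrow> s < q) \<and> (d < c \<longleftrightarrow> s < r)" for a b c d p q r s
    unfolding order_isomorphic_def by (simp add: All_less_Suc2 conj_ac)
  have "contains_pattern \<sigma> [4, 1, 2, 3] \<longleftrightarrow>
      (\<exists>a b c d. subseq [a, b, c, d] \<sigma> \<and> b < c \<and> c < d \<and> d < a)"
    unfolding contains_pattern_4 iso by (intro ex_cong1) auto
  moreover have "contains_pattern \<sigma> [1, 3, 2, 4] \<longleftrightarrow>
      (\<exists>a b c d. subseq [a, b, c, d] \<sigma> \<and> a < c \<and> c < b \<and> b < d)"
    unfolding contains_pattern_4 iso by (intro ex_cong1) auto
  moreover have "contains_pattern \<sigma> [3, 1, 2, 4] \<longleftrightarrow>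
      (\<exists>a b c d. subseq [a, b, c, d] \<sigma> \<and> b < c \<and> c < a \<and> a < d)"
    unfolding contains_pattern_4 iso by (intro ex_cong1) auto
  ultimately show ?thesis
    unfolding good_def by (simp add: conj_disj_distribL ex_disj_distrib)
qed

section \<open>Subsequences of a list with an inserted letter\<close>

text \<open>An embedding either skips the inserted letter or uses it. \<open>N\<close> may also
  occur elsewhere, so the alternatives can overlap.\<close>

lemma subseq_insert_iff:
  "subseq l (xs @ N # ys) \<longleftrightarrow>
     subseq l (xs @ ys) \<or> (\<exists>l1 l2. l = l1 @ N # l2 \<and> subseq l1 xs \<and> subseq l2 ys)"
proof -
  have "subseq l2 (N # ys) \<longleftrightarrow> subseq l2 ys \<or> (\<exists>l3. l2 = N # l3 \<and> subseq l3 ys)" for l2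
    by (cases l2) (auto elim: subseq_Cons')
  thus ?thesis by (auto simp: subseq_append_iff)
qed

text \<open>As a rewrite rule this peels an explicit list letter by letter, turning the choice of a
  split into a finite disjunction.\<close>

lemma ex_split_Cons:
  "(\<exists>l1 l2. x # l = l1 @ N # l2 \<and> R l1 l2) \<longleftrightarrow>
     x = N \<and> R [] l \<or> (\<exists>l1 l2. l = l1 @ N # l2 \<and> R (x # l1) l2)"
  by (auto simp: Cons_eq_append_conv)

lemma subseq_insert_max_4:
  "subseq [a, b, c, d] (xs @ N # ys) \<longleftrightarrow> subseq [a, b, c, d] (xs @ ys)
     \<or> a = N \<and> subseq [b, c, d] ys
     \<or> b = N \<and> a \<in> set xs \<and> subseq [c, d] ys
     \<or> c = N \<and> subseq [a, b] xs \<and> d \<in> set ys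
     \<or> d = N \<and> subseq [a, b, c] xs"
  unfolding subseq_insert_iff ex_split_Cons by (auto simp: subseq_singleton_left)

lemma subseq_insert_max_3:
  "subseq [a, b, c] (xs @ N # ys) \<longleftrightarrow> subseq [a, b, c] (xs @ ys)
     \<or> a = N \<and> subseq [b, c] ys
     \<or> b = N \<and> a \<in> set xs \<and> c \<in> set ys
     \<or> c = N \<and> subseq [a, b] xs"
  unfolding subseq_insert_iff ex_split_Cons by (auto simp: subseq_singleton_left)

lemma subseq_set: "subseq l xs \<Longrightarrow> x \<in> set l \<Longrightarrow> x \<in> set xs"
  by (auto dest: list_emb_set)

text \<open>A new maximum can only play the 4 of a pattern: the first letter of 4123, leaving a 123
  after it, or the last letter of 1324 or 3124, leaving a 132 or 312 before it.\<close>

lemma good_insert_max: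
  assumes N: "\<forall>x\<in>set (xs @ ys). x < N"
  shows "good (xs @ N # ys) \<longleftrightarrow> good (xs @ ys) \<and> no_132_312 xs \<and> no_123 ys"
proof
  assume g: "good (xs @ N # ys)"
  have "good (xs @ ys)"
    using g unfolding good_def subseq_insert_max_4 by blast
  moreover have "no_132_312 xs"
    unfolding no_132_312_def
  proof (intro notI, elim exE conjE)
    fix a b c assume s: "subseq [a, b, c] xs" and o: "a < c \<and> c < b \<or> b < c \<and> c < a"
    have "a < N" "b < N" using N subseq_set[OF s] by auto
    thus False using g s o unfolding good_def subseq_insert_max_4 by blast
  qed
  moreover have "no_123 ys"
    unfolding no_123_def
  proof (intro notI, elim exE conjE)
    fix a b c assume s: "subseq [a, b, c] ys" and o: "a < b" "b < c"
    have "c < N" using N subseq_set[OF s] by auto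
    thus False using g s o unfolding good_def subseq_insert_max_4 by blast
  qed
  ultimately show "good (xs @ ys) \<and> no_132_312 xs \<and> no_123 ys" by blast
next
  assume g: "good (xs @ ys) \<and> no_132_312 xs \<and> no_123 ys"
  show "good (xs @ N # ys)"
    unfolding good_def
  proof (intro notI, elim exE conjE)
    fix a b c d assume s: "subseq [a, b, c, d] (xs @ N # ys)"
      and o: "b < c \<and> c < d \<and> d < a \<or> a < c \<and> c < b \<and> b < d \<or> b < c \<and> c < a \<and> a < d"
    have le: "x \<le> N" if "x \<in> set [a, b, c, d]" for x
      using subseq_set[OF s that] N by (auto simp: less_imp_le)
    have "a \<le> N" "b \<le> N" "c \<le> N" "d \<le> N" by (auto intro: le)
    \<comment> \<open>In every pattern the second and third letters lie below some other letter, so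
      neither can be \<open>N\<close>.\<close>
    with s o consider "subseq [a, b, c, d] (xs @ ys)" | "a = N" "subseq [b, c, d] ys"
      | "d = N" "subseq [a, b, c] xs"
      unfolding subseq_insert_max_4 by (metis leD)
    thus False
    proof cases
      case 1 thus False using g o unfolding good_def by blast
    next
      case 2
      with \<open>d \<le> N\<close> o have "b < c \<and> c < d" by auto
      thus False using 2 g unfolding no_123_def by blast
    next
      case 3
      with \<open>a \<le> N\<close> o have "a < c \<and> c < b \<or> b < c \<and> c < a" by auto
      thus False using 3 g unfolding no_132_312_def by blast
    qed
  qed
qed

section \<open>Left-to-right minima and maxima\<close>

text \<open>\<open>x\<close> is a position, not a value. Position 0 is vacuously both a minimum and
  a maximum.\<close>

definition lr_min :: "nat list \<Rightarrow> nat \<Rightarrow> bool" where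
  "lr_min \<sigma> x \<longleftrightarrow> (\<forall>y<x. \<sigma> ! x < \<sigma> ! y)"

definition lr_max :: "nat list \<Rightarrow> nat \<Rightarrow> bool" where
  "lr_max \<sigma> x \<longleftrightarrow> (\<forall>y<x. \<sigma> ! y < \<sigma> ! x)"

lemma lr_min_not_lr_max: "0 < x \<Longrightarrow> lr_min \<sigma> x \<Longrightarrow> lr_max \<sigma> x \<Longrightarrow> False"
  unfolding lr_min_def lr_max_def using less_asym by blast

text \<open>The last letter plays the 2 in both patterns, and together they forbid the two outer
  letters in either order. So \<open>c\<close> must not lie strictly between two earlier
  values.\<close>

lemma no_132_312_snoc:
  assumes "distinct (xs @ [c])"
  shows "no_132_312 (xs @ [c]) \<longleftrightarrow>
    no_132_312 xs \<and> ((\<forall>y\<in>set xs. c < y) \<or> (\<forall>y\<in>set xs. y < c))"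
proof -
  have two: "subseq [a, b] xs \<or> subseq [b, a] xs" if ab: "a \<in> set xs" "b \<in> set xs" "a \<noteq> b" for a b
  proof -
    obtain us vs where xs: "xs = us @ a # vs" using ab(1) by (meson split_list)
    hence "b \<in> set us \<or> b \<in> set vs" using ab by auto
    thus ?thesis
      unfolding xs subseq_insert_iff ex_split_Cons by (auto simp: subseq_singleton_left)
  qed
  have "no_132_312 (xs @ [c]) \<longleftrightarrow> no_132_312 xs \<and>
      \<not> (\<exists>a b. subseq [a, b] xs \<and> (a < c \<and> c < b \<or> b < c \<and> c < a))"
    unfolding no_132_312_def subseq_insert_max_3 append_Nil2 by simp blast
  also have "(\<exists>a b. subseq [a, b] xs \<and> (a < c \<and> c < b \<or> b < c \<and> c < a)) \<longleftrightarrow>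
      (\<exists>a\<in>set xs. \<exists>b\<in>set xs. a < c \<and> c < b)"
  proof (intro iffI; elim exE bexE conjE)
    fix a b assume s: "subseq [a, b] xs" and o: "a < c \<and> c < b \<or> b < c \<and> c < a"
    have "a \<in> set xs" "b \<in> set xs" using subseq_set[OF s] by auto
    thus "\<exists>a\<in>set xs. \<exists>b\<in>set xs. a < c \<and> c < b" using o by blast
  next
    fix a b assume ab: "a \<in> set xs" "b \<in> set xs" "a < c" "c < b"
    hence "subseq [a, b] xs \<or> subseq [b, a] xs" by (intro two) auto
    thus "\<exists>a b. subseq [a, b] xs \<and> (a < c \<and> c < b \<or> b < c \<and> c < a)" using ab by blast
  qed
  also have "\<not> \<dots> \<longleftrightarrow> (\<forall>y\<in>set xs. c < y) \<or> (\<forall>y\<in>set xs. y < c)"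
  proof -
    have "c \<notin> set xs" using assms by simp
    hence "y < c \<longleftrightarrow> \<not> c < y" if "y \<in> set xs" for y using that by (metis not_less_iff_gr_or_eq)
    thus ?thesis by blast
  qed
  finally show ?thesis .
qed

lemma no_132_312_take:
  assumes "distinct \<sigma>" "i \<le> length \<sigma>"
  shows "no_132_312 (take i \<sigma>) \<longleftrightarrow> (\<forall>x<i. lr_min \<sigma> x \<or> lr_max \<sigma> x)"
  using assms(2)
proof (induction i)
  case 0
  show ?case by (simp add: no_132_312_def)
next
  case (Suc i)
  have t: "take (Suc i) \<sigma> = take i \<sigma> @ [\<sigma> ! i]"
    using Suc.prems by (simp add: take_Suc_conv_app_nth)
  have d: "distinct (take i \<sigma> @ [\<sigma> ! i])"
    unfolding t[symmetric] using assms(1) by (rule distinct_take)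
  have "set (take i \<sigma>) = (!) \<sigma> ` {..<i}"
    using Suc.prems by (simp add: nth_image lessThan_atLeast0)
  hence "no_132_312 (take (Suc i) \<sigma>) \<longleftrightarrow> no_132_312 (take i \<sigma>) \<and> (lr_min \<sigma> i \<or> lr_max \<sigma> i)"
    unfolding t no_132_312_snoc[OF d] lr_min_def lr_max_def by (auto simp: ball_simps)
  also have "no_132_312 (take i \<sigma>) \<longleftrightarrow> (\<forall>x<i. lr_min \<sigma> x \<or> lr_max \<sigma> x)"
    using Suc by simp
  also have "\<dots> \<and> (lr_min \<sigma> i \<or> lr_max \<sigma> i) \<longleftrightarrow> (\<forall>x<Suc i. lr_min \<sigma> x \<or> lr_max \<sigma> x)"
    unfolding All_less_Suc by blast
  finally show ?case .
qed

text \<open>A new maximum can only play the 3, which requires an increasing pair before it.\<close>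

lemma no_123_insert_max:
  assumes "\<forall>x\<in>set (us @ ys). x < N"
  shows "no_123 (us @ N # ys) \<longleftrightarrow> no_123 (us @ ys) \<and> no_12 us"
proof (intro iffI conjI)
  assume l: "no_123 (us @ N # ys)"
  show "no_123 (us @ ys)"
    using l unfolding no_123_def subseq_insert_max_3 by blast
  show "no_12 us"
    unfolding no_12_def
  proof (intro notI, elim exE conjE)
    fix a b assume s: "subseq [a, b] us" and "a < b"
    moreover have "b < N" using assms subseq_set[OF s] by simp
    ultimately show False using l unfolding no_123_def subseq_insert_max_3 by blast
  qed
next
  assume l: "no_123 (us @ ys) \<and> no_12 us"
  show "no_123 (us @ N # ys)"
    unfolding no_123_def
  proof (intro notI, elim exE conjE)
    fix a b c assume s: "subseq [a, b, c] (us @ N # ys)" and o: "a < b" "b < c"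
    have "c \<le> N" using subseq_set[OF s, of c] assms by (auto simp: less_imp_le)
    hence "a \<noteq> N" "b \<noteq> N" using o by auto
    hence "subseq [a, b, c] (us @ ys) \<or> subseq [a, b] us"
      using s unfolding subseq_insert_max_3 by blast
    thus False using l o unfolding no_123_def no_12_def by blast
  qed
qed

lemma no_12_iff: "no_12 xs \<longleftrightarrow> (\<forall>x y. x < y \<and> y < length xs \<longrightarrow> xs ! y \<le> xs ! x)"
proof -
  have "no_12 xs \<longleftrightarrow> sorted_wrt (\<lambda>a b. b \<le> a) xs"
  proof (induction xs)
    case (Cons z zs)
    have "subseq [a, b] (z # zs) \<longleftrightarrow> subseq [a, b] zs \<or> a = z \<and> b \<in> set zs" for a b
      using subseq_insert_iff[of "[a, b]" "[]" z zs]
      by (auto simp: Cons_eq_append_conv subseq_singleton_left)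
    with Cons show ?case unfolding no_12_def by (auto simp: not_less)
  qed (simp add: no_12_def)
  thus ?thesis unfolding sorted_wrt_iff_nth_less by blast
qed

section \<open>Active sites and their change under insertion\<close>

definition ins :: "nat \<Rightarrow> nat \<Rightarrow> nat list \<Rightarrow> nat list" where
  "ins i N \<sigma> = take i \<sigma> @ N # drop i \<sigma>"

definition sites :: "nat list \<Rightarrow> nat set" where
  "sites \<sigma> = {i. i \<le> length \<sigma> \<and> no_132_312 (take i \<sigma>) \<and> no_123 (drop i \<sigma>)}"

text \<open>\<^term>\<open>hi\<close> is the length of the longest prefix consisting of left-to-right minima and
  maxima, so that the active sites are exactly those from \<^term>\<open>lo\<close> to \<^term>\<open>hi\<close>.\<close>

definition profile :: "nat \<Rightarrow> nat \<Rightarrow> nat list \<Rightarrow> bool" where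
  "profile lo hi \<sigma> \<longleftrightarrow> hi \<le> length \<sigma> \<and>
     (\<forall>x<hi. lr_min \<sigma> x \<or> lr_max \<sigma> x) \<and>
     (hi < length \<sigma> \<longrightarrow> \<not> lr_min \<sigma> hi \<and> \<not> lr_max \<sigma> hi) \<and>
     (\<forall>j\<le>length \<sigma>. no_123 (drop j \<sigma>) \<longleftrightarrow> lo \<le> j)"

lemma sites_profile:
  assumes "distinct \<sigma>" "profile lo hi \<sigma>"
  shows "sites \<sigma> = {lo..hi}"
proof -
  have "(\<forall>x<i. lr_min \<sigma> x \<or> lr_max \<sigma> x) \<longleftrightarrow> i \<le> hi" if "i \<le> length \<sigma>" for i
    using assms(2) that unfolding profile_def by (metis le_eq_less_or_eq less_le_trans not_less)
  thus ?thesis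
    using assms by (auto simp: sites_def no_132_312_take profile_def)
qed

lemma length_ins [simp]: "i \<le> length \<sigma> \<Longrightarrow> length (ins i N \<sigma>) = Suc (length \<sigma>)"
  by (simp add: ins_def)

lemma nth_ins:
  "i \<le> length \<sigma> \<Longrightarrow> ins i N \<sigma> ! x = (if x < i then \<sigma> ! x else if x = i then N else \<sigma> ! (x - 1))"
  by (auto simp: ins_def nth_append nth_Cons' min_def)

context
  fixes \<sigma> :: "nat list" and N i :: nat
  assumes N: "\<forall>x\<in>set \<sigma>. x < N" and i: "i \<le> length \<sigma>"
begin

lemma lr_ins_less:
  assumes "x < i"
  shows "lr_min (ins i N \<sigma>) x \<longleftrightarrow> lr_min \<sigma> x" "lr_max (ins i N \<sigma>) x \<longleftrightarrow> lr_max \<sigma> x"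
  using assms i by (auto simp: lr_min_def lr_max_def nth_ins)

lemma lr_max_ins: "lr_max (ins i N \<sigma>) i"
  using N i by (auto simp: lr_max_def nth_ins)

lemma lr_min_ins: "lr_min (ins i N \<sigma>) i \<longleftrightarrow> i = 0"
proof -
  have "0 < i \<Longrightarrow> \<sigma> ! 0 < N" using N i by (metis less_le_trans nth_mem)
  thus ?thesis using i by (auto simp: lr_min_def nth_ins dest: less_asym)
qed

text \<open>Old positions from the site on shift by one. The new letter exceeds all others, so it
  rules out every later maximum and no later minimum.\<close>

lemma lr_ins_greater:
  assumes "i \<le> x" "x < length \<sigma>"
  shows "lr_min (ins i N \<sigma>) (Suc x) \<longleftrightarrow> lr_min \<sigma> x" "\<not> lr_max (ins i N \<sigma>) (Suc x)"
proof -
  have lt: "\<sigma> ! x < N" using N assms by simp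
  show "\<not> lr_max (ins i N \<sigma>) (Suc x)"
    using lt assms i by (auto simp: lr_max_def nth_ins intro!: exI[of _ i])
  show "lr_min (ins i N \<sigma>) (Suc x) \<longleftrightarrow> lr_min \<sigma> x"
  proof
    assume l: "lr_min (ins i N \<sigma>) (Suc x)"
    show "lr_min \<sigma> x"
      unfolding lr_min_def
    proof (intro allI impI)
      fix y assume "y < x"
      thus "\<sigma> ! x < \<sigma> ! y"
        using l assms i unfolding lr_min_def
        by (cases "y < i") (auto simp: nth_ins dest: spec[of _ y] spec[of _ "Suc y"])
    qed
  next
    assume "lr_min \<sigma> x"
    thus "lr_min (ins i N \<sigma>) (Suc x)"
      using lt assms i by (auto simp: lr_min_def nth_ins)
  qed
qed

text \<open>If the suffix contains the new letter, the segment between \<open>j\<close> and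
  \<open>i\<close> must decrease. As \<open>i \<le> hi\<close>, its entries are minima or maxima, so
  it decreases exactly if all of them after position \<open>j\<close> are minima.\<close>

lemma no_123_drop_ins:
  assumes p: "profile lo hi \<sigma>" and j: "j \<le> Suc (length \<sigma>)" and lo: "lo \<le> i" and hi: "i \<le> hi"
  shows "no_123 (drop j (ins i N \<sigma>)) \<longleftrightarrow> i < j \<or> lo \<le> j \<and> (\<forall>x. j < x \<and> x < i \<longrightarrow> lr_min \<sigma> x)"
proof (cases "i < j")
  case True
  \<comment> \<open>The suffix starts after the new letter, and
    \<open>j - 1 \<ge> i \<ge> lo\<close>.\<close>
  have "drop j (ins i N \<sigma>) = drop (j - 1) \<sigma>"
    using True i by (cases j) (auto simp: ins_def Suc_diff_le)
  thus ?thesis using True p j lo by (auto simp: profile_def)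
next
  case False
  have seg: "drop j (ins i N \<sigma>) = take (i - j) (drop j \<sigma>) @ N # drop i \<sigma>"
    using False i by (simp add: ins_def drop_take)
  have cat: "take (i - j) (drop j \<sigma>) @ drop i \<sigma> = drop j \<sigma>"
    using False by (metis append_take_drop_id drop_drop le_add_diff_inverse2 not_less)
  have "\<forall>x\<in>set (drop j \<sigma>). x < N" using N by (meson in_set_dropD)
  hence "no_123 (drop j (ins i N \<sigma>)) \<longleftrightarrow> no_123 (drop j \<sigma>) \<and> no_12 (take (i - j) (drop j \<sigma>))"
    unfolding seg using no_123_insert_max[of "take (i - j) (drop j \<sigma>)" "drop i \<sigma>" N] cat by simp
  also have "no_123 (drop j \<sigma>) \<longleftrightarrow> lo \<le> j"
    using p False i by (auto simp: profile_def)
  also have "no_12 (take (i - j) (drop j \<sigma>)) \<longleftrightarrow> (\<forall>x. j < x \<and> x < i \<longrightarrow> lr_min \<sigma> x)"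
  proof
    assume d: "no_12 (take (i - j) (drop j \<sigma>))"
    show "\<forall>x. j < x \<and> x < i \<longrightarrow> lr_min \<sigma> x"
    proof (intro allI impI)
      fix x assume x: "j < x \<and> x < i"
      \<comment> \<open>Comparing \<open>x\<close> with its left neighbour is enough: a value not
        above the neighbour's is no maximum, hence a minimum.\<close>
      have "x - 1 - j < x - j \<and> x - j < length (take (i - j) (drop j \<sigma>))"
        using x i by auto
      hence "take (i - j) (drop j \<sigma>) ! (x - j) \<le> take (i - j) (drop j \<sigma>) ! (x - 1 - j)"
        using d unfolding no_12_iff by blast
      moreover have "x - j < i - j" "x - 1 - j < i - j" "j + (x - j) = x" "j + (x - 1 - j) = x - 1"
        using x by auto
      ultimately have "\<sigma> ! x \<le> \<sigma> ! (x - 1)" using x i by (simp only: nth_take nth_drop)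
      hence "\<not> lr_max \<sigma> x" using x by (auto simp: lr_max_def not_less intro!: exI[of _ "x - 1"])
      moreover have "x < hi" using x hi by simp
      ultimately show "lr_min \<sigma> x" using p unfolding profile_def by blast
    qed
  next
    assume l: "\<forall>x. j < x \<and> x < i \<longrightarrow> lr_min \<sigma> x"
    show "no_12 (take (i - j) (drop j \<sigma>))"
      unfolding no_12_iff
    proof (intro allI impI)
      fix x y assume xy: "x < y \<and> y < length (take (i - j) (drop j \<sigma>))"
      hence "lr_min \<sigma> (j + y)" using l i by auto
      hence "\<sigma> ! (j + y) < \<sigma> ! (j + x)" using xy by (simp add: lr_min_def)
      thus "take (i - j) (drop j \<sigma>) ! y \<le> take (i - j) (drop j \<sigma>) ! x" using xy i False by simp
    qed
  qed
  finally show ?thesis using False by simp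
qed

text \<open>After the new letter only minima extend the prefix, so it ends at the first non-minimum
  \<open>h\<close> from \<open>i\<close> on, shifted by one. The lower end moves to the last
  non-minimum \<open>lo'\<close> between \<open>lo\<close> and \<open>i\<close>, or stays at
  \<open>lo\<close>.\<close>

lemma profile_ins:
  assumes p: "profile lo hi \<sigma>" and lo: "lo \<le> i" and hi: "i \<le> hi"
    and h: "i \<le> h" "h \<le> length \<sigma>" "\<And>x. i \<le> x \<Longrightarrow> x < h \<Longrightarrow> lr_min \<sigma> x"
      "h < length \<sigma> \<Longrightarrow> \<not> lr_min \<sigma> h"
    and lo': "lo \<le> lo'" "lo' \<le> i" "\<And>x. lo' < x \<Longrightarrow> x < i \<Longrightarrow> lr_min \<sigma> x"
      "lo < lo' \<Longrightarrow> lo' < i \<and> \<not> lr_min \<sigma> lo'"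
  shows "profile lo' (Suc h) (ins i N \<sigma>)"
  unfolding profile_def
proof (intro conjI allI impI)
  show "Suc h \<le> length (ins i N \<sigma>)" using h(2) i by simp
  show "lr_min (ins i N \<sigma>) x \<or> lr_max (ins i N \<sigma>) x" if x: "x < Suc h" for x
  proof (cases x i rule: linorder_cases)
    case less
    thus ?thesis using p hi by (simp add: lr_ins_less profile_def)
  next
    case equal
    thus ?thesis using lr_max_ins by simp
  next
    case greater
    then obtain x' where "x = Suc x'" "i \<le> x'" by (cases x) auto
    thus ?thesis using h x by (simp add: lr_ins_greater)
  qed
  show "\<not> lr_min (ins i N \<sigma>) (Suc h)" "\<not> lr_max (ins i N \<sigma>) (Suc h)"
    if "Suc h < length (ins i N \<sigma>)"
    using that h i by (auto simp: lr_ins_greater)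
  show "no_123 (drop j (ins i N \<sigma>)) \<longleftrightarrow> lo' \<le> j" if j: "j \<le> length (ins i N \<sigma>)" for j
  proof -
    have "j \<le> Suc (length \<sigma>)" using j i by simp
    note no_123_drop_ins[OF p this lo hi]
    moreover have "(i < j \<or> lo \<le> j \<and> (\<forall>x. j < x \<and> x < i \<longrightarrow> lr_min \<sigma> x)) \<longleftrightarrow> lo' \<le> j"
    proof (cases "lo' \<le> j")
      case True
      thus ?thesis using lo' by (meson le_trans le_less_trans)
    next
      case False
      \<comment> \<open>If \<open>lo \<le> j\<close>, then \<open>lo'\<close> itself is a
        non-minimum strictly between \<open>j\<close> and \<open>i\<close>.\<close>
      hence "\<not> (lo \<le> j \<and> (\<forall>x. j < x \<and> x < i \<longrightarrow> lr_min \<sigma> x))"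
        using lo'(4) by (metis le_less_trans not_less)
      thus ?thesis using False lo'(2) by auto
    qed
    ultimately show ?thesis by simp
  qed
qed

end

section \<open>States of permutations\<close>

text \<open>Writing m and M for left-to-right minima and maxima, the labels describe the prefix of
  length \<^term>\<open>hi\<close>: it is $m^r$ for \<^term>\<open>D r\<close> and $m^p M m^k$ for \<^term>\<open>A p k\<close>, both with
  \<^term>\<open>lo = (0::nat)\<close>; from position \<^term>\<open>lo > (0::nat)\<close> on it is $M m^j M m^k$ for \<^term>\<open>B j k\<close>
  and $M$ for \<^term>\<open>C\<close>.\<close>

fun state :: "label \<Rightarrow> nat \<Rightarrow> nat list \<Rightarrow> bool" where
  "state (D r) lo \<sigma> \<longleftrightarrow> lo = 0 \<and> profile 0 r \<sigma> \<and> (\<forall>x<r. lr_min \<sigma> x)"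
| "state (A p k) lo \<sigma> \<longleftrightarrow> lo = 0 \<and> 0 < p \<and> profile 0 (Suc (p + k)) \<sigma> \<and> lr_max \<sigma> p \<and>
     (\<forall>x\<le>p + k. x \<noteq> p \<longrightarrow> lr_min \<sigma> x)"
| "state (B j k) lo \<sigma> \<longleftrightarrow> 0 < lo \<and> profile lo (Suc (Suc (lo + j + k))) \<sigma> \<and> lr_max \<sigma> lo \<and>
     lr_max \<sigma> (Suc (lo + j)) \<and>
     (\<forall>x. lo < x \<and> x \<le> Suc (lo + j + k) \<and> x \<noteq> Suc (lo + j) \<longrightarrow> lr_min \<sigma> x)"
| "state C lo \<sigma> \<longleftrightarrow> 0 < lo \<and> profile lo (Suc lo) \<sigma> \<and> lr_max \<sigma> lo"

text \<open>In front, the new letter is vacuously a minimum and lengthens the run of minima; at a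
  later site \<open>i\<close> it becomes a maximum that splits the run.\<close>

lemma state_D_insert:
  assumes s: "state (D r) lo \<sigma>" and N: "\<forall>x\<in>set \<sigma>. x < N"
  shows "state (D (Suc r)) 0 (ins 0 N \<sigma>)"
    and "0 < i \<Longrightarrow> i \<le> r \<Longrightarrow> state (A i (r - i)) 0 (ins i N \<sigma>)"
proof -
  from s have p: "profile 0 r \<sigma>" and m: "\<And>x. x < r \<Longrightarrow> lr_min \<sigma> x" by auto
  have r: "r \<le> length \<sigma>" "r < length \<sigma> \<Longrightarrow> \<not> lr_min \<sigma> r" using p by (auto simp: profile_def)
  note mn = lr_min_ins[OF N] and mx = lr_max_ins[OF N] and lt = lr_ins_less[OF N]
    and gt = lr_ins_greater[OF N]
  have "profile 0 (Suc r) (ins 0 N \<sigma>)"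
    by (rule profile_ins[OF N _ p]) (use m r in auto)
  moreover have "lr_min (ins 0 N \<sigma>) x" if "x < Suc r" for x
    using that m r by (cases x) (simp_all add: mn gt)
  ultimately show "state (D (Suc r)) 0 (ins 0 N \<sigma>)" by simp
  assume i: "0 < i" "i \<le> r"
  have "profile 0 (Suc r) (ins i N \<sigma>)"
    by (rule profile_ins[OF N _ p]) (use m r i in auto)
  moreover have "lr_min (ins i N \<sigma>) x" if "x \<le> r" "x \<noteq> i" for x
  proof (cases "x < i")
    case True
    thus ?thesis using m i r by (simp add: lt)
  next
    case False
    hence "i < x" using that by simp
    then obtain x' where "x = Suc x'" "i \<le> x'" by (cases x) auto
    thus ?thesis using m i r that by (simp add: gt)
  qed
  moreover have "lr_max (ins i N \<sigma>) i" using mx i r by simp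
  ultimately show "state (A i (r - i)) 0 (ins i N \<sigma>)" using i by simp
qed

text \<open>Insertion at a site up to \<open>p\<close> turns the old maximum into a non-extremal
  entry, which cuts the prefix there. Beyond \<open>p\<close>, a minimum, the old maximum and the
  new letter form a 123, so \<open>lo\<close> moves to \<open>p\<close>.\<close>

lemma state_A_insert:
  assumes s: "state (A p k) lo \<sigma>" and N: "\<forall>x\<in>set \<sigma>. x < N"
  shows "state (D (Suc p)) 0 (ins 0 N \<sigma>)"
    and "0 < i \<Longrightarrow> i \<le> p \<Longrightarrow> state (A i (p - i)) 0 (ins i N \<sigma>)"
    and "t \<le> k \<Longrightarrow> state (B t (k - t)) p (ins (Suc (p + t)) N \<sigma>)"
proof -
  from s have p: "profile 0 (Suc (p + k)) \<sigma>" and m: "\<And>x. x \<le> p + k \<Longrightarrow> x \<noteq> p \<Longrightarrow> lr_min \<sigma> x"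
    and p0: "0 < p" and M: "lr_max \<sigma> p" by auto
  have r: "Suc (p + k) \<le> length \<sigma>" "Suc (p + k) < length \<sigma> \<Longrightarrow> \<not> lr_min \<sigma> (Suc (p + k))"
    using p by (auto simp: profile_def)
  have nm: "\<not> lr_min \<sigma> p" using M p0 lr_min_not_lr_max by blast
  note mn = lr_min_ins[OF N] and mx = lr_max_ins[OF N] and lt = lr_ins_less[OF N]
    and gt = lr_ins_greater[OF N]
  have "profile 0 (Suc p) (ins 0 N \<sigma>)"
    by (rule profile_ins[OF N _ p]) (use m r nm in auto)
  moreover have "lr_min (ins 0 N \<sigma>) x" if "x < Suc p" for x
    using that m r by (cases x) (simp_all add: mn gt)
  ultimately show "state (D (Suc p)) 0 (ins 0 N \<sigma>)" by simp
  {
    assume i: "0 < i" "i \<le> p"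
    have "profile 0 (Suc p) (ins i N \<sigma>)"
      by (rule profile_ins[OF N _ p]) (use m r nm i in auto)
    moreover have "lr_min (ins i N \<sigma>) x" if "x \<le> p" "x \<noteq> i" for x
    proof (cases "x < i")
      case True
      thus ?thesis using m i r by (simp add: lt)
    next
      case False
      hence "i < x" using that by simp
      then obtain x' where "x = Suc x'" "i \<le> x'" by (cases x) auto
      thus ?thesis using m i r that by (simp add: gt)
    qed
    moreover have "lr_max (ins i N \<sigma>) i" using mx i r by simp
    ultimately show "state (A i (p - i)) 0 (ins i N \<sigma>)" using i by simp
  }
  assume t: "t \<le> k"
  define i where "i = Suc (p + t)"
  have i: "i \<le> length \<sigma>" "p < i" "i \<le> Suc (p + k)" using t r by (auto simp: i_def)
  have "profile p (Suc (Suc (p + k))) (ins i N \<sigma>)"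
    by (rule profile_ins[OF N _ p]) (use m r nm p0 i in auto)
  moreover have "lr_min (ins i N \<sigma>) x" if "p < x" "x \<le> Suc (p + k)" "x \<noteq> i" for x
  proof (cases "x < i")
    case True
    thus ?thesis using m i r that by (simp add: lt)
  next
    case False
    hence "i < x" using that by simp
    then obtain x' where "x = Suc x'" "i \<le> x'" by (cases x) auto
    thus ?thesis using m i r that by (simp add: gt)
  qed
  moreover have "lr_max (ins i N \<sigma>) i" using mx i by simp
  moreover have "lr_max (ins i N \<sigma>) p" using M i by (simp add: lt)
  ultimately have "state (B t (k - t)) p (ins i N \<sigma>)" using t p0 by (simp add: i_def)
  thus "state (B t (k - t)) p (ins (Suc (p + t)) N \<sigma>)" by (simp only: i_def)
qed

text \<open>The prefix is cut at the first old maximum to the right of the new letter. Behind the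
  second maximum, both old maxima and the new letter form a 123, so \<open>lo\<close> moves to that
  second maximum.\<close>

lemma state_B_insert:
  assumes s: "state (B j k) lo \<sigma>" and N: "\<forall>x\<in>set \<sigma>. x < N"
  shows "state C lo (ins lo N \<sigma>)"
    and "t \<le> j \<Longrightarrow> state (B t (j - t)) lo (ins (Suc (lo + t)) N \<sigma>)"
    and "t \<le> k \<Longrightarrow> state (B t (k - t)) (Suc (lo + j)) (ins (Suc (Suc (lo + j + t))) N \<sigma>)"
proof -
  define mid hi where "mid = Suc (lo + j)" and "hi = Suc (Suc (lo + j + k))"
  from s have p: "profile lo hi \<sigma>" and m: "\<And>x. lo < x \<Longrightarrow> x < hi \<Longrightarrow> x \<noteq> mid \<Longrightarrow> lr_min \<sigma> x"
    and lo: "0 < lo" and M: "lr_max \<sigma> lo" "lr_max \<sigma> mid" by (auto simp: mid_def hi_def)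
  have r: "hi \<le> length \<sigma>" "hi < length \<sigma> \<Longrightarrow> \<not> lr_min \<sigma> hi"
    using p by (auto simp: profile_def)
  have mid: "lo < mid" "mid < hi" by (auto simp: mid_def hi_def)
  have nm: "\<not> lr_min \<sigma> lo" "\<not> lr_min \<sigma> mid" using M lo mid lr_min_not_lr_max[of lo \<sigma>] lr_min_not_lr_max[of mid \<sigma>] by auto
  note mx = lr_max_ins[OF N] and lt = lr_ins_less[OF N] and gt = lr_ins_greater[OF N]
  have "profile lo (Suc lo) (ins lo N \<sigma>)"
    by (rule profile_ins[OF N _ p]) (use r nm mid in auto)
  thus "state C lo (ins lo N \<sigma>)" using lo mx r mid by simp
  {
    assume t: "t \<le> j"
    define i where "i = Suc (lo + t)"
    have i: "i \<le> length \<sigma>" "lo < i" "i \<le> mid" using t r mid by (auto simp: i_def mid_def)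
    have "profile lo (Suc mid) (ins i N \<sigma>)"
      by (rule profile_ins[OF N _ p]) (use m r nm mid i in auto)
    moreover have "lr_min (ins i N \<sigma>) x" if "lo < x" "x \<le> mid" "x \<noteq> i" for x
    proof (cases "x < i")
      case True
      thus ?thesis using m i r mid that by (simp add: lt)
    next
      case False
      hence "i < x" using that by simp
      then obtain x' where "x = Suc x'" "i \<le> x'" by (cases x) auto
      thus ?thesis using m i r mid that by (simp add: gt)
    qed
    moreover have "lr_max (ins i N \<sigma>) i" using mx i by simp
    moreover have "lr_max (ins i N \<sigma>) lo" using M i by (simp add: lt)
    ultimately have "state (B t (j - t)) lo (ins i N \<sigma>)" using t lo by (simp add: i_def mid_def)
    thus "state (B t (j - t)) lo (ins (Suc (lo + t)) N \<sigma>)" by (simp only: i_def)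
  }
  assume t: "t \<le> k"
  define i where "i = Suc (mid + t)"
  have i: "i \<le> length \<sigma>" "mid < i" "i \<le> hi" using t r by (auto simp: i_def mid_def hi_def)
  have "profile mid (Suc hi) (ins i N \<sigma>)"
    by (rule profile_ins[OF N _ p]) (use m r nm mid i in auto)
  moreover have "lr_min (ins i N \<sigma>) x" if "mid < x" "x \<le> hi" "x \<noteq> i" for x
  proof (cases "x < i")
    case True
    thus ?thesis using m i r mid that by (simp add: lt)
  next
    case False
    hence "i < x" using that by simp
    then obtain x' where "x = Suc x'" "i \<le> x'" by (cases x) auto
    thus ?thesis using m i r mid that by (simp add: gt)
  qed
  moreover have "lr_max (ins i N \<sigma>) i" using mx i by simp
  moreover have "lr_max (ins i N \<sigma>) mid" using M i by (simp add: lt)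
  ultimately have "state (B t (k - t)) mid (ins i N \<sigma>)" using t by (simp add: i_def mid_def hi_def add.assoc)
  thus "state (B t (k - t)) (Suc (lo + j)) (ins (Suc (Suc (lo + j + t))) N \<sigma>)"
    by (simp add: i_def mid_def)
qed

lemma state_C_insert:
  assumes s: "state C lo \<sigma>" and N: "\<forall>x\<in>set \<sigma>. x < N"
  shows "state C lo (ins lo N \<sigma>)"
    and "state (B 0 0) lo (ins (Suc lo) N \<sigma>)"
proof -
  from s have p: "profile lo (Suc lo) \<sigma>" and lo: "0 < lo" and M: "lr_max \<sigma> lo" by auto
  have r: "Suc lo \<le> length \<sigma>" "Suc lo < length \<sigma> \<Longrightarrow> \<not> lr_min \<sigma> (Suc lo)"
    using p by (auto simp: profile_def)
  have nm: "\<not> lr_min \<sigma> lo" using M lo lr_min_not_lr_max by auto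
  note mx = lr_max_ins[OF N]
  have "profile lo (Suc lo) (ins lo N \<sigma>)"
    by (rule profile_ins[OF N _ p]) (use r nm in auto)
  thus "state C lo (ins lo N \<sigma>)" using lo mx r by simp
  have "profile lo (Suc (Suc lo)) (ins (Suc lo) N \<sigma>)"
    by (rule profile_ins[OF N _ p]) (use r nm in auto)
  moreover have "lr_max (ins (Suc lo) N \<sigma>) lo" using M r by (simp add: lr_ins_less[OF N])
  moreover have "lr_max (ins (Suc lo) N \<sigma>) (Suc lo)" using mx r by simp
  ultimately show "state (B 0 0) lo (ins (Suc lo) N \<sigma>)" using lo by auto
qed

lemma state_children:
  assumes s: "state l lo \<sigma>" and N: "\<forall>x\<in>set \<sigma>. x < N" and t: "t < length (children l)"
  shows "\<exists>lo'. state (children l ! t) lo' (ins (lo + t) N \<sigma>)"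
proof (cases l)
  case (D r)
  show ?thesis
  proof (cases t)
    case 0
    thus ?thesis using s D state_D_insert(1)[OF _ N, of r lo] by auto
  next
    case (Suc u)
    hence "children l ! t = A t (r - t)" using t D by (simp del: upt_Suc)
    thus ?thesis using s D t Suc state_D_insert(2)[OF _ N, of r lo t] by (auto simp del: upt_Suc)
  qed
next
  case (A p k)
  have "lo = 0" using s A by simp
  \<comment> \<open>The cases are the three blocks of the list of children; the last block starts at
    index \<open>Suc p\<close>.\<close>
  consider "t = 0" | "0 < t" "t \<le> p" | u where "t = Suc (p + u)" "u \<le> k"
    using t A by (cases "t \<le> p") (auto simp del: upt_Suc dest!: less_imp_Suc_add simp: not_le)
  thus ?thesis
  proof cases
    case 1
    thus ?thesis using s A state_A_insert(1)[OF _ N, of p k lo] by auto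
  next
    case 2
    hence "children l ! t = A t (p - t)" using A by (cases t) (auto simp del: upt_Suc simp: nth_append)
    thus ?thesis using 2 s A state_A_insert(2)[OF _ N, of p k lo t] \<open>lo = 0\<close> by auto
  next
    case 3
    hence "children l ! t = B u (k - u)" using A by (simp del: upt_Suc add: nth_append)
    thus ?thesis using 3 s A state_A_insert(3)[OF _ N, of p k lo u] \<open>lo = 0\<close> by auto
  qed
next
  case (B j k)
  consider "t = 0" | u where "t = Suc u" "u \<le> j" | u where "t = Suc (Suc (j + u))" "u \<le> k"
    using t B by (cases t; cases "t \<le> Suc j")
      (auto simp del: upt_Suc dest!: less_imp_Suc_add simp: not_le)
  thus ?thesis
  proof cases
    case 1
    thus ?thesis using s B state_B_insert(1)[OF _ N, of j k lo] by auto
  next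
    case 2
    hence "children l ! t = B u (j - u)" using B by (simp del: upt_Suc add: nth_append)
    thus ?thesis using 2 s B state_B_insert(2)[OF _ N, of j k lo u] by auto
  next
    case 3
    hence "children l ! t = B u (k - u)" using B by (simp del: upt_Suc add: nth_append)
    thus ?thesis using 3 s B state_B_insert(3)[OF _ N, of j k lo u]
      by (auto simp: add.assoc simp del: state.simps)
  qed
next
  case C
  hence "t = 0 \<or> t = Suc 0" using t by auto
  thus ?thesis
    using s C state_C_insert[OF _ N, of lo] by (auto simp del: state.simps)
qed

text \<open>In every state the number of children is \<open>hi - lo + 1\<close>.\<close>

lemma state_sites:
  assumes "state l lo \<sigma>" "distinct \<sigma>"
  shows "sites \<sigma> = {lo..<lo + length (children l)}"
  using assms by (cases l) (auto simp: sites_profile simp del: upt_Suc)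

section \<open>Counting\<close>

definition avoiders :: "nat \<Rightarrow> nat list set" where
  "avoiders n = {\<sigma> \<in> perms n. good \<sigma>}"

lemma avoiders_eq: "avoiders n = perms n \<inter> Av {[4, 1, 2, 3], [1, 3, 2, 4], [3, 1, 2, 4]}"
  unfolding avoiders_def Av_def good_iff by blast

lemma perms_iff: "\<sigma> \<in> perms n \<longleftrightarrow> distinct \<sigma> \<and> set \<sigma> = {1..n}"
  by (auto simp: perms_def permutations_of_set_def)

lemma length_perms: "\<sigma> \<in> perms n \<Longrightarrow> length \<sigma> = n"
  by (metis perms_iff distinct_card card_atLeastAtMost diff_Suc_1)

lemma set_ins: "set (ins i N \<sigma>) = insert N (set \<sigma>)"
  unfolding ins_def by (metis append_take_drop_id insert_is_Un set_append Un_insert_right list.simps(15))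

lemma ins_perms: "\<sigma> \<in> perms n \<Longrightarrow> ins i (Suc n) \<sigma> \<in> perms (Suc n)"
proof -
  assume s: "\<sigma> \<in> perms n"
  have "distinct (xs @ N # ys)" if "distinct (xs @ ys)" "N \<notin> set (xs @ ys)" for xs ys and N :: nat
    using that by auto
  from this[of "take i \<sigma>" "drop i \<sigma>" "Suc n"] have "distinct (ins i (Suc n) \<sigma>)"
    using s by (simp add: perms_iff ins_def)
  thus ?thesis using s by (auto simp: perms_iff set_ins)
qed

text \<open>The inverse deletes the maximum \<open>Suc n\<close>, whose single occurrence determines
  the split.\<close>

lemma bij_betw_ins:
  "bij_betw (\<lambda>(\<sigma>, i). ins i (Suc n) \<sigma>) (SIGMA \<sigma>:avoiders n. sites \<sigma>) (avoiders (Suc n))"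
  unfolding bij_betw_def
proof
  have notin: "Suc n \<notin> set (take i \<sigma>)" "Suc n \<notin> set (drop i \<sigma>)" if "\<sigma> \<in> avoiders n" for i \<sigma>
    using that by (auto simp: avoiders_def perms_iff dest: in_set_takeD in_set_dropD)
  show "inj_on (\<lambda>(\<sigma>, i). ins i (Suc n) \<sigma>) (SIGMA \<sigma>:avoiders n. sites \<sigma>)"
  proof (rule inj_onI, clarify)
    fix \<sigma> i \<tau> j
    assume a: "\<sigma> \<in> avoiders n" "i \<in> sites \<sigma>" "\<tau> \<in> avoiders n" "j \<in> sites \<tau>"
      and eq: "ins i (Suc n) \<sigma> = ins j (Suc n) \<tau>"
    have e: "take i \<sigma> = take j \<tau>" "drop i \<sigma> = drop j \<tau>"
      using eq notin[OF a(1), of i] unfolding ins_def by (simp_all add: append_Cons_eq_iff)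
    have "\<sigma> = \<tau>" using e by (metis append_take_drop_id)
    moreover have "i = j"
    proof -
      have "i \<le> length \<sigma>" "j \<le> length \<tau>" using a by (simp_all add: sites_def)
      thus ?thesis using arg_cong[OF e(1), of length] by simp
    qed
    ultimately show "\<sigma> = \<tau> \<and> i = j" ..
  qed
  have split: "good (ins i (Suc n) \<sigma>) \<longleftrightarrow>
      good \<sigma> \<and> no_132_312 (take i \<sigma>) \<and> no_123 (drop i \<sigma>)" if "\<sigma> \<in> perms n" for i \<sigma>
  proof -
    have "\<forall>x\<in>set (take i \<sigma> @ drop i \<sigma>). x < Suc n" using that by (auto simp: perms_iff)
    from good_insert_max[OF this] show ?thesis by (simp add: ins_def)
  qed
  show "(\<lambda>(\<sigma>, i). ins i (Suc n) \<sigma>) ` (SIGMA \<sigma>:avoiders n. sites \<sigma>) = avoiders (Suc n)"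
  proof (intro equalityI subsetI)
    fix \<tau> assume "\<tau> \<in> (\<lambda>(\<sigma>, i). ins i (Suc n) \<sigma>) ` (SIGMA \<sigma>:avoiders n. sites \<sigma>)"
    thus "\<tau> \<in> avoiders (Suc n)"
      by (auto simp: avoiders_def sites_def split ins_perms)
  next
    fix \<tau> assume t: "\<tau> \<in> avoiders (Suc n)"
    hence "Suc n \<in> set \<tau>" by (auto simp: avoiders_def perms_iff)
    then obtain xs ys where \<tau>: "\<tau> = xs @ Suc n # ys" by (meson split_list)
    define \<sigma> where "\<sigma> = xs @ ys"
    have i: "\<tau> = ins (length xs) (Suc n) \<sigma>" "length xs \<le> length \<sigma>" by (auto simp: \<tau> \<sigma>_def ins_def)
    have "distinct \<tau>" "set \<tau> = {1..Suc n}" using t by (auto simp: avoiders_def perms_iff)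
    hence "distinct \<sigma>" "Suc n \<notin> set \<sigma>" "insert (Suc n) (set \<sigma>) = {1..Suc n}"
      by (auto simp: \<tau> \<sigma>_def)
    moreover from this have "set \<sigma> = {1..Suc n} - {Suc n}" by blast
    moreover have "{1..Suc n} - {Suc n} = {1..n}" by auto
    ultimately have "\<sigma> \<in> perms n" by (simp add: perms_iff)
    moreover have "good \<tau>" using t by (simp add: avoiders_def)
    ultimately have "\<sigma> \<in> avoiders n" "length xs \<in> sites \<sigma>"
      using split[of \<sigma> "length xs"] i by (auto simp: avoiders_def sites_def)
    thus "\<tau> \<in> (\<lambda>(\<sigma>, i). ins i (Suc n) \<sigma>) ` (SIGMA \<sigma>:avoiders n. sites \<sigma>)"
      using i by force
  qed
qed

text \<open>For a permutation, \<open>Suc (length \<sigma>)\<close> is the next maximum, so this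
  counts the avoiders reached by \<open>m\<close> further insertions.\<close>

primrec descendants :: "nat \<Rightarrow> nat list \<Rightarrow> nat" where
  "descendants 0 \<sigma> = 1"
| "descendants (Suc m) \<sigma> = (\<Sum>i\<in>sites \<sigma>. descendants m (ins i (Suc (length \<sigma>)) \<sigma>))"

lemma finite_avoiders: "finite (avoiders n)"
  by (simp add: avoiders_def perms_def)

lemma card_avoiders: "card (avoiders (n + m)) = (\<Sum>\<sigma>\<in>avoiders n. descendants m \<sigma>)"
proof (induction m arbitrary: n)
  case (Suc m)
  have fin: "finite (sites \<sigma>)" for \<sigma> by (simp add: sites_def)
  have "card (avoiders (n + Suc m)) = (\<Sum>\<tau>\<in>avoiders (Suc n). descendants m \<tau>)"
    using Suc.IH[of "Suc n"] by simp
  also have "\<dots> = (\<Sum>(\<sigma>, i)\<in>(SIGMA \<sigma>:avoiders n. sites \<sigma>). descendants m (ins i (Suc n) \<sigma>))"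
    by (subst sum.reindex_bij_betw[OF bij_betw_ins, symmetric]) (simp add: case_prod_unfold)
  also have "\<dots> = (\<Sum>\<sigma>\<in>avoiders n. \<Sum>i\<in>sites \<sigma>. descendants m (ins i (Suc n) \<sigma>))"
    by (rule sum.Sigma[symmetric]) (simp_all add: finite_avoiders fin)
  also have "\<dots> = (\<Sum>\<sigma>\<in>avoiders n. descendants (Suc m) \<sigma>)"
    by (rule sum.cong) (auto simp: avoiders_def length_perms)
  finally show ?case .
qed simp

text \<open>Active sites correspond in order to the children of the label, and each insertion yields
  a permutation in the state of that child, so the count depends on the label alone.\<close>

lemma descendants_eq:
  "\<sigma> \<in> perms n \<Longrightarrow> state l lo \<sigma> \<Longrightarrow> descendants m \<sigma> = tree_count m l"
proof (induction m arbitrary: n l lo \<sigma>)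
  case (Suc m)
  let ?L = "length (children l)"
  have N: "\<forall>x\<in>set \<sigma>. x < Suc n" using Suc.prems by (simp add: perms_iff)
  have step: "descendants m (ins (lo + t) (Suc n) \<sigma>) = tree_count m (children l ! t)" if "t < ?L" for t
    using state_children[OF Suc.prems(2) N that] Suc.IH[OF ins_perms[OF Suc.prems(1)]] by blast
  have "descendants (Suc m) \<sigma> = (\<Sum>i\<in>{lo..<lo + ?L}. descendants m (ins i (Suc n) \<sigma>))"
  proof -
    have "sites \<sigma> = {lo..<lo + ?L}"
      using state_sites[OF Suc.prems(2)] Suc.prems(1) by (simp add: perms_iff)
    thus ?thesis by (simp only: descendants.simps length_perms[OF Suc.prems(1)])
  qed
  also have "\<dots> = (\<Sum>t<?L. descendants m (ins (lo + t) (Suc n) \<sigma>))"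
    by (rule sum.reindex_bij_witness[of _ "\<lambda>t. lo + t" "\<lambda>i. i - lo"]) auto
  also have "\<dots> = (\<Sum>t<?L. tree_count m (children l ! t))"
    by (rule sum.cong) (auto simp: step)
  also have "\<dots> = tree_count (Suc m) l"
    unfolding tree_count.simps sum_list_sum_nth length_map lessThan_atLeast0
    by (rule sum.cong) simp_all
  finally show ?case .
qed simp

lemma card_avoiders_eq: "card (avoiders n) = tree_count n (D 0)"
proof -
  have "no_123 []" by (simp add: no_123_def)
  \<comment> \<open>The empty permutation is the root, with an empty run of minima.\<close>
  hence "state (D 0) 0 []" by (simp add: profile_def)
  moreover have "[] \<in> perms 0" by (simp add: perms_iff)
  ultimately have "descendants n [] = tree_count n (D 0)" by (rule descendants_eq[rotated])
  moreover have "avoiders 0 = {[]}" by (auto simp: avoiders_def perms_iff good_def)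
  ultimately show ?thesis using card_avoiders[of 0 n] by simp
qed

theorem theorem2p4:
  shows "perm_class_gf (Av {[4, 1, 2, 3], [1, 3, 2, 4], [3, 1, 2, 4]}) =
           ((1 - 3 * fps_X) * (1 + fps_sqrt (1 - 4 * fps_X))) /
           (2 * fps_sqrt (1 - 4 * fps_X) * (1 - 3 * fps_X + fps_X ^ 2))"
  unfolding gf_root[symmetric] perm_class_gf_def tree_gf_def avoiders_eq[symmetric] card_avoiders_eq
  by (rule refl)

end
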